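(* Let $\mathcal M$ and $\mathcal N$ be finite-dimensional Riemannian manifolds, and let $\mathcal X\subset\mathcal M$ and $\mathcal Y\subset\mathcal N$ be g-convex and uniquely geodesic subsets. Let $f:\mathcal X\times\mathcal Y\to\mathbb R$ be a function such that $f(\cdot,y)$ is lower semicontinuous and quasi g-convex for all $y\in\mathcal Y$, $f(x,\cdot)$ is upper semicontinuous and quasi g-concave for all $x\in\mathcal X$, and $f$ is inf-sup-compact at some $(x_1,y_1)\in\mathcal X\times\mathcal Y$. Then $$\min_{x\in\mathcal X}\max_{y\in\mathcal Y}f(x,y)=\max_{y\in\mathcal Y}\min_{x\in\mathcal X}f(x,y).$$
   Context: A geodesic is a unit-speed curve that is locally distance minimizing. A set is g-convex if every two of its points are connected by a geodesic that remains in the set, and uniquely geodesic if every two of its points are connected by one and only one geodesic. $f(\cdot,y)$ is quasi g-convex if all its sublevel sets $\{x\in\mathcal X: f(x,y)\le\alpha\}$, $\alpha\in\mathbb R$, are g-convex; $f(x,\cdot)$ is quasi g-concave if all its superlevel sets $\{y\in\mathcal Y: f(x,y)\ge\alpha\}$, $\alpha\in\mathbb R$, are g-convex. $f$ is inf-sup-compact at $(\tilde x,\tilde y)\in\mathcal X\times\mathcal Y$ if the sublevel sets of $f(\cdot,\tilde y)$ and the superlevel sets of $f(\tilde x,\cdot)$ are compact. *)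

theory Defs
  imports "HOL-Analysis.Analysis"
begin

section \<open>Smooth maps between open subsets of a linear space\<close>

text \<open>
  The coordinate space is a linear subspace \<open>V\<close> of a Euclidean space, so that every finite
  dimension occurs, including dimension 0 (whereas \<open>DIM('e) \<ge> 1\<close> for every type
  \<open>'e :: euclidean_space\<close>). Only derivatives in directions of \<open>V\<close> are meaningful.
\<close>

definition dir_deriv :: "('e::real_normed_vector \<Rightarrow> 'f::real_normed_vector) \<Rightarrow> 'e \<Rightarrow> 'e \<Rightarrow> 'f" where
  "dir_deriv h x v = vector_derivative (\<lambda>t::real. h (x + t *\<^sub>R v)) (at 0)"

primrec Ck_on :: "'e::real_normed_vector set \<Rightarrow> 'e set \<Rightarrow> nat \<Rightarrow> ('e \<Rightarrow> 'f::real_normed_vector) \<Rightarrow> bool" where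
  "Ck_on V W 0 h \<longleftrightarrow> continuous_on W h"
| "Ck_on V W (Suc k) h \<longleftrightarrow> continuous_on W h \<and>
     (\<forall>v\<in>V. (\<forall>x\<in>W. (\<lambda>t::real. h (x + t *\<^sub>R v)) differentiable (at 0)) \<and>
            Ck_on V W k (\<lambda>x. dir_deriv h x v))"

definition smooth_on :: "'e::real_normed_vector set \<Rightarrow> 'e set \<Rightarrow> ('e \<Rightarrow> 'f::real_normed_vector) \<Rightarrow> bool" where
  "smooth_on V W h \<longleftrightarrow> (\<forall>k. Ck_on V W k h)"

section \<open>Riemannian manifolds\<close>

text \<open>
  A chart is a pair of its domain and its coordinate map. The metric tensor is given by its
  coordinate expressions: \<open>mtensor M c x v w\<close> is the inner product of the tangent vectors with
  components \<open>v\<close>, \<open>w\<close> with respect to the chart \<open>c\<close>, at the point with coordinates \<open>x\<close>.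
\<close>

type_synonym ('a, 'e) chart = "'a set \<times> ('a \<Rightarrow> 'e)"

record ('a, 'e) riem_data =
  mtop :: "'a topology"
  model :: "'e set"
  atlas :: "('a, 'e) chart set"
  mtensor :: "('a, 'e) chart \<Rightarrow> 'e \<Rightarrow> 'e \<Rightarrow> 'e \<Rightarrow> real"

definition transition :: "('a, 'e) chart \<Rightarrow> ('a, 'e) chart \<Rightarrow> 'e \<Rightarrow> 'e" where
  "transition c c' = snd c' \<circ> inv_into (fst c) (snd c)"

definition topological_manifold :: "('a, 'e::euclidean_space) riem_data \<Rightarrow> bool" where
  "topological_manifold M \<longleftrightarrow>
     Hausdorff_space (mtop M) \<and>
     (\<exists>\<B>. countable \<B> \<and> (\<forall>U\<in>\<B>. openin (mtop M) U) \<and>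
        (\<forall>W p. openin (mtop M) W \<and> p \<in> W \<longrightarrow> (\<exists>U\<in>\<B>. p \<in> U \<and> U \<subseteq> W))) \<and>
     subspace (model M) \<and>
     topspace (mtop M) = (\<Union>c\<in>atlas M. fst c) \<and>
     (\<forall>c\<in>atlas M. openin (mtop M) (fst c) \<and>
        openin (top_of_set (model M)) (snd c ` fst c) \<and>
        homeomorphic_map (subtopology (mtop M) (fst c)) (top_of_set (snd c ` fst c)) (snd c))"

definition smooth_manifold :: "('a, 'e::euclidean_space) riem_data \<Rightarrow> bool" where
  "smooth_manifold M \<longleftrightarrow> topological_manifold M \<and>
     (\<forall>c\<in>atlas M. \<forall>c'\<in>atlas M.
        smooth_on (model M) (snd c ` (fst c \<inter> fst c')) (transition c c'))"

definition riemannian_manifold :: "('a, 'e::euclidean_space) riem_data \<Rightarrow> bool" where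
  "riemannian_manifold M \<longleftrightarrow> smooth_manifold M \<and>
     (\<forall>c\<in>atlas M.
        (\<forall>x\<in>snd c ` fst c.
           bilinear (mtensor M c x) \<and>
           (\<forall>v\<in>model M. \<forall>w\<in>model M. mtensor M c x v w = mtensor M c x w v) \<and>
           (\<forall>v\<in>model M. v \<noteq> 0 \<longrightarrow> 0 < mtensor M c x v v)) \<and>
        (\<forall>v\<in>model M. \<forall>w\<in>model M. smooth_on (model M) (snd c ` fst c) (\<lambda>x. mtensor M c x v w))) \<and>
     (\<forall>c\<in>atlas M. \<forall>c'\<in>atlas M. \<forall>x\<in>snd c ` (fst c \<inter> fst c'). \<forall>v\<in>model M. \<forall>w\<in>model M.
        mtensor M c x v w =
        mtensor M c' (transition c c' x)
          (dir_deriv (transition c c') x v) (dir_deriv (transition c c') x w))"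

section \<open>Curves, length and distance\<close>

definition C1_curve :: "('a, 'e::euclidean_space) riem_data \<Rightarrow> real \<Rightarrow> real \<Rightarrow> (real \<Rightarrow> 'a) \<Rightarrow> bool" where
  "C1_curve M a b \<gamma> \<longleftrightarrow>
     continuous_map (top_of_set {a..b}) (mtop M) \<gamma> \<and>
     (\<forall>c\<in>atlas M.
        (\<forall>t\<in>{a..b}. \<gamma> t \<in> fst c \<longrightarrow> (snd c \<circ> \<gamma>) differentiable (at t within {a..b})) \<and>
        continuous_on {t \<in> {a..b}. \<gamma> t \<in> fst c}
          (\<lambda>t. vector_derivative (snd c \<circ> \<gamma>) (at t within {a..b})))"

definition piecewise_C1_curve :: "('a, 'e::euclidean_space) riem_data \<Rightarrow> real \<Rightarrow> real \<Rightarrow> (real \<Rightarrow> 'a) \<Rightarrow> bool" where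
  "piecewise_C1_curve M a b \<gamma> \<longleftrightarrow>
     continuous_map (top_of_set {a..b}) (mtop M) \<gamma> \<and>
     (\<exists>P. finite P \<and>
        (\<forall>s t. a \<le> s \<and> s < t \<and> t \<le> b \<and> {s<..<t} \<inter> P = {} \<longrightarrow> C1_curve M s t \<gamma>))"

text \<open>
  By the transformation law of the metric tensor, the speed does not depend on the chart that is
  chosen around \<open>\<gamma> t\<close>. At the finitely many break points of a piecewise C1 curve its value is
  irrelevant for the length.
\<close>

definition speed :: "('a, 'e::euclidean_space) riem_data \<Rightarrow> real \<Rightarrow> real \<Rightarrow> (real \<Rightarrow> 'a) \<Rightarrow> real \<Rightarrow> real" where
  "speed M a b \<gamma> t =
     (let c = (SOME c. c \<in> atlas M \<and> \<gamma> t \<in> fst c);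
          v = vector_derivative (snd c \<circ> \<gamma>) (at t within {a..b})
      in sqrt (mtensor M c (snd c (\<gamma> t)) v v))"

definition curve_length :: "('a, 'e::euclidean_space) riem_data \<Rightarrow> real \<Rightarrow> real \<Rightarrow> (real \<Rightarrow> 'a) \<Rightarrow> real" where
  "curve_length M a b \<gamma> = integral {a..b} (speed M a b \<gamma>)"

text \<open>The distance of points in different connected components is \<open>\<infinity>\<close>.\<close>

definition rdist :: "('a, 'e::euclidean_space) riem_data \<Rightarrow> 'a \<Rightarrow> 'a \<Rightarrow> ereal" where
  "rdist M p q =
     Inf {ereal (curve_length M a b \<gamma>) | a b \<gamma>.
            a \<le> b \<and> piecewise_C1_curve M a b \<gamma> \<and> \<gamma> a = p \<and> \<gamma> b = q}"

section \<open>Geodesics and g-convexity\<close>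

text \<open>
  Geodesics are parametrized on \<open>{0..L}\<close>, which rules out translations of the parameter; two of
  them are the same curve if they agree on \<open>{0..L}\<close>.
\<close>

definition geodesic :: "('a, 'e::euclidean_space) riem_data \<Rightarrow> real \<Rightarrow> (real \<Rightarrow> 'a) \<Rightarrow> bool" where
  "geodesic M L \<gamma> \<longleftrightarrow> 0 < L \<and> C1_curve M 0 L \<gamma> \<and>
     (\<forall>t\<in>{0..L}. speed M 0 L \<gamma> t = 1) \<and>
     (\<forall>t\<in>{0..L}. \<exists>e>0. \<forall>r\<in>{0..L}. \<forall>s\<in>{0..L}.
        r \<le> s \<and> \<bar>r - t\<bar> < e \<and> \<bar>s - t\<bar> < e \<longrightarrow>
        rdist M (\<gamma> r) (\<gamma> s) = ereal (curve_length M r s \<gamma>))"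

definition geodesic_between ::
  "('a, 'e::euclidean_space) riem_data \<Rightarrow> 'a \<Rightarrow> 'a \<Rightarrow> real \<Rightarrow> (real \<Rightarrow> 'a) \<Rightarrow> bool" where
  "geodesic_between M p q L \<gamma> \<longleftrightarrow> geodesic M L \<gamma> \<and> \<gamma> 0 = p \<and> \<gamma> L = q"

definition g_convex :: "('a, 'e::euclidean_space) riem_data \<Rightarrow> 'a set \<Rightarrow> bool" where
  "g_convex M S \<longleftrightarrow> S \<subseteq> topspace (mtop M) \<and>
     (\<forall>p\<in>S. \<forall>q\<in>S. p \<noteq> q \<longrightarrow> (\<exists>L \<gamma>. geodesic_between M p q L \<gamma> \<and> \<gamma> ` {0..L} \<subseteq> S))"

definition uniquely_geodesic :: "('a, 'e::euclidean_space) riem_data \<Rightarrow> 'a set \<Rightarrow> bool" where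
  "uniquely_geodesic M S \<longleftrightarrow> S \<subseteq> topspace (mtop M) \<and>
     (\<forall>p\<in>S. \<forall>q\<in>S. p \<noteq> q \<longrightarrow>
        (\<exists>L \<gamma>. geodesic_between M p q L \<gamma> \<and>
           (\<forall>L' \<gamma>'. geodesic_between M p q L' \<gamma>' \<longrightarrow> L' = L \<and> (\<forall>t\<in>{0..L}. \<gamma>' t = \<gamma> t))))"

definition quasi_g_convex :: "('a, 'e::euclidean_space) riem_data \<Rightarrow> 'a set \<Rightarrow> ('a \<Rightarrow> real) \<Rightarrow> bool" where
  "quasi_g_convex M S h \<longleftrightarrow> (\<forall>\<alpha>. g_convex M {p\<in>S. h p \<le> \<alpha>})"

definition quasi_g_concave :: "('a, 'e::euclidean_space) riem_data \<Rightarrow> 'a set \<Rightarrow> ('a \<Rightarrow> real) \<Rightarrow> bool" where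
  "quasi_g_concave M S h \<longleftrightarrow> (\<forall>\<alpha>. g_convex M {p\<in>S. h p \<ge> \<alpha>})"

section \<open>Semicontinuity, compactness of level sets and minimax values\<close>

definition lower_semicontinuous_map :: "'a topology \<Rightarrow> ('a \<Rightarrow> real) \<Rightarrow> bool" where
  "lower_semicontinuous_map T h \<longleftrightarrow>
     (\<forall>p\<in>topspace T. \<forall>c<h p. \<exists>U. openin T U \<and> p \<in> U \<and> (\<forall>z\<in>U. c < h z))"

definition upper_semicontinuous_map :: "'a topology \<Rightarrow> ('a \<Rightarrow> real) \<Rightarrow> bool" where
  "upper_semicontinuous_map T h \<longleftrightarrow>
     (\<forall>p\<in>topspace T. \<forall>c>h p. \<exists>U. openin T U \<and> p \<in> U \<and> (\<forall>z\<in>U. h z < c))"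

definition inf_sup_compact_at ::
  "'a topology \<Rightarrow> 'b topology \<Rightarrow> 'a set \<Rightarrow> 'b set \<Rightarrow> ('a \<Rightarrow> 'b \<Rightarrow> real) \<Rightarrow> 'a \<Rightarrow> 'b \<Rightarrow> bool" where
  "inf_sup_compact_at S T X Y f x\<^sub>1 y\<^sub>1 \<longleftrightarrow>
     (\<forall>\<alpha>. compactin S {x\<in>X. f x y\<^sub>1 \<le> \<alpha>}) \<and> (\<forall>\<alpha>. compactin T {y\<in>Y. f x\<^sub>1 y \<ge> \<alpha>})"

text \<open>
  \<open>v\<close> is the value of ``min over x of max over y'': the outer minimum is attained at some \<open>x\<close>,
  and at this \<open>x\<close> the inner maximum is attained at some \<open>y\<close>. At other points the inner supremum
  need not be attained and may be \<open>\<infinity>\<close>, even when a saddle point exists (for instance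
  \<open>f x y = x * y - (1 - x) * y\<^sup>2\<close> on \<open>[0, 1] \<times> \<real>\<close> at \<open>x = 1\<close>), hence the
  extended reals. Dually for ``max over y of min over x''.
\<close>

definition is_min_max :: "'a set \<Rightarrow> 'b set \<Rightarrow> ('a \<Rightarrow> 'b \<Rightarrow> real) \<Rightarrow> real \<Rightarrow> bool" where
  "is_min_max X Y f v \<longleftrightarrow>
     (INF x\<in>X. SUP y\<in>Y. ereal (f x y)) = ereal v \<and>
     (\<exists>x\<in>X. (SUP y\<in>Y. ereal (f x y)) = ereal v \<and> (\<exists>y\<in>Y. f x y = v))"

definition is_max_min :: "'a set \<Rightarrow> 'b set \<Rightarrow> ('a \<Rightarrow> 'b \<Rightarrow> real) \<Rightarrow> real \<Rightarrow> bool" where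
  "is_max_min X Y f v \<longleftrightarrow>
     (SUP y\<in>Y. INF x\<in>X. ereal (f x y)) = ereal v \<and>
     (\<exists>y\<in>Y. (INF x\<in>X. ereal (f x y)) = ereal v \<and> (\<exists>x\<in>X. f x y = v))"

end

theory Submission
  imports Defs
begin

text \<open>
  Komiya's elementary proof of Sion's theorem carries over, because it uses segments only through
  their connectedness. Since geodesics are unique, the geodesic from \<open>y\<close> to \<open>y'\<close> lies in every
  superlevel set of every \<open>f x\<close> that contains both endpoints, and intersections of sublevel sets
  are again g-convex, hence connected. If the sublevel sets of \<open>f _ y\<close> and \<open>f _ y'\<close> at level
  \<open>\<beta>\<close> are disjoint, then each sublevel set of \<open>f _ z\<close>, for \<open>z\<close> on the geodesic, lies in
  one of them; if all of them were nonempty at a lower level \<open>\<alpha>\<close>, this would disconnect the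
  geodesic. Iterating gives the statement for finitely many points of \<open>Y\<close>, and compactness of
  a sublevel set reduces the general case to this one.
\<close>

section \<open>Connectedness of g-convex sets\<close>

lemma geodesic_between_imp_connectedin:
  assumes "geodesic_between M p q L \<gamma>"
  shows "connectedin (mtop M) (\<gamma> ` {0..L})" "p \<in> \<gamma> ` {0..L}" "q \<in> \<gamma> ` {0..L}"
proof -
  have "continuous_map (top_of_set {0..L}) (mtop M) \<gamma>" "0 < L" "\<gamma> 0 = p" "\<gamma> L = q"
    using assms by (auto simp: geodesic_between_def geodesic_def C1_curve_def)
  moreover have "connectedin (top_of_set {0..L}) {0..L}"
    by (simp add: connectedin_subtopology)
  ultimately show "connectedin (mtop M) (\<gamma> ` {0..L})" "p \<in> \<gamma> ` {0..L}" "q \<in> \<gamma> ` {0..L}"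
    by (auto intro: connectedin_continuous_map_image)
qed

text \<open>Fixing a base point \<open>p\<close>, the set is the union of connected pieces (geodesic
  images, or \<open>{p}\<close> itself) that all contain \<open>p\<close>.\<close>

lemma g_convex_imp_connectedin:
  assumes "g_convex M A"
  shows "connectedin (mtop M) A"
proof (cases "A = {}")
  case False
  then obtain p where p: "p \<in> A" by blast
  have "\<exists>C. connectedin (mtop M) C \<and> p \<in> C \<and> q \<in> C \<and> C \<subseteq> A" if "q \<in> A" for q
  proof (cases "p = q")
    case True
    then show ?thesis
      using assms p by (intro exI[of _ "{p}"]) (auto simp: g_convex_def)
  next
    case False
    then obtain L \<gamma> where "geodesic_between M p q L \<gamma>" "\<gamma> ` {0..L} \<subseteq> A"
      using assms p \<open>q \<in> A\<close> unfolding g_convex_def by blast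
    then show ?thesis
      using geodesic_between_imp_connectedin[of M p q L \<gamma>] by blast
  qed
  then obtain C where C: "\<And>q. q \<in> A \<Longrightarrow> connectedin (mtop M) (C q) \<and> p \<in> C q \<and> q \<in> C q \<and> C q \<subseteq> A"
    by metis
  have "connectedin (mtop M) (\<Union> (C ` A))"
    using C p by (intro connectedin_Union) auto
  moreover have "\<Union> (C ` A) = A"
    using C by blast
  ultimately show ?thesis by simp
qed auto

text \<open>Uniqueness is among all geodesics of \<open>M\<close> joining two points of
  \<open>X\<close>, so the curves that witness g-convexity of \<open>A\<close> and of
  \<open>B\<close> coincide, and this one curve stays in both sets.\<close>

lemma uniquely_geodesic_g_convex_Int:
  assumes "uniquely_geodesic M X" "A \<subseteq> X" "g_convex M A" "g_convex M B"
  shows "g_convex M (A \<inter> B)"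
  unfolding g_convex_def
proof (intro conjI ballI impI)
  show "A \<inter> B \<subseteq> topspace (mtop M)"
    using assms by (auto simp: g_convex_def)
next
  fix p q assume pq: "p \<in> A \<inter> B" "q \<in> A \<inter> B" "p \<noteq> q"
  obtain L \<gamma> where \<gamma>: "geodesic_between M p q L \<gamma>" "\<gamma> ` {0..L} \<subseteq> A"
    using assms(3) pq unfolding g_convex_def by blast
  obtain L' \<gamma>' where \<gamma>': "geodesic_between M p q L' \<gamma>'" "\<gamma>' ` {0..L'} \<subseteq> B"
    using assms(4) pq unfolding g_convex_def by blast
  have "L' = L \<and> (\<forall>t\<in>{0..L}. \<gamma>' t = \<gamma> t)"
    using assms(1,2) pq \<gamma>(1) \<gamma>'(1) unfolding uniquely_geodesic_def
    by (metis IntD1 subsetD)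
  then have "\<gamma> ` {0..L} \<subseteq> B"
    using \<gamma>'(2) by auto
  then show "\<exists>L \<gamma>. geodesic_between M p q L \<gamma> \<and> \<gamma> ` {0..L} \<subseteq> A \<inter> B"
    using \<gamma> by blast
qed

text \<open>\<open>Z\<close> plays the role of a line segment. Its connectedness and its minimality
  among g-convex sets through both endpoints are all that the minimax argument uses of it.\<close>

lemma uniquely_geodesic_segment:
  assumes "uniquely_geodesic M X" "p \<in> X" "q \<in> X"
  obtains Z where "connectedin (mtop M) Z" "p \<in> Z" "q \<in> Z"
    "\<And>A. g_convex M A \<Longrightarrow> p \<in> A \<Longrightarrow> q \<in> A \<Longrightarrow> Z \<subseteq> A"
proof (cases "p = q")
  \<comment> \<open>\<open>geodesic\<close> demands \<open>0 < L\<close>, so coinciding endpoints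
    get the singleton as their segment.\<close>
  case True
  show thesis
    by (rule that[of "{p}"]) (use assms True in \<open>auto simp: uniquely_geodesic_def\<close>)
next
  case False
  then obtain L \<gamma> where \<gamma>: "geodesic_between M p q L \<gamma>"
    and uniq: "\<And>L' \<gamma>'. geodesic_between M p q L' \<gamma>' \<Longrightarrow> L' = L \<and> (\<forall>t\<in>{0..L}. \<gamma>' t = \<gamma> t)"
    using assms unfolding uniquely_geodesic_def by metis
  show thesis
  proof (rule that[of "\<gamma> ` {0..L}"])
    fix A assume "g_convex M A" "p \<in> A" "q \<in> A"
    then obtain L' \<gamma>' where "geodesic_between M p q L' \<gamma>'" "\<gamma>' ` {0..L'} \<subseteq> A"
      using False unfolding g_convex_def by blast
    with uniq[of L' \<gamma>'] show "\<gamma> ` {0..L} \<subseteq> A" by auto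
  qed (use geodesic_between_imp_connectedin[OF \<gamma>] in auto)
qed

section \<open>Semicontinuity\<close>

lemma lower_semicontinuous_map_openin:
  assumes "lower_semicontinuous_map T h"
  shows "openin T {p \<in> topspace T. c < h p}"
proof (subst openin_subopen, safe)
  fix p assume "p \<in> topspace T" "c < h p"
  then obtain U where "openin T U" "p \<in> U" "\<forall>z\<in>U. c < h z"
    using assms unfolding lower_semicontinuous_map_def by blast
  then show "\<exists>U. openin T U \<and> p \<in> U \<and> U \<subseteq> {p \<in> topspace T. c < h p}"
    using openin_subset by blast
qed

lemma lower_semicontinuous_map_uminus:
  "lower_semicontinuous_map T (\<lambda>p. - h p) \<longleftrightarrow> upper_semicontinuous_map T h"
proof -
  have "(\<forall>c < - h p. \<exists>U. openin T U \<and> p \<in> U \<and> (\<forall>z\<in>U. c < - h z)) \<longleftrightarrow>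
        (\<forall>c > h p. \<exists>U. openin T U \<and> p \<in> U \<and> (\<forall>z\<in>U. h z < c))" (is "?L \<longleftrightarrow> ?R") for p
  proof
    assume ?L
    show ?R
      using spec[OF \<open>?L\<close>, of "- _"] by (auto simp: less_minus_iff)
  next
    assume ?R
    show ?L
      using spec[OF \<open>?R\<close>, of "- _"] by (auto simp: minus_less_iff less_minus_iff)
  qed
  then show ?thesis
    unfolding lower_semicontinuous_map_def upper_semicontinuous_map_def by simp
qed

lemma upper_semicontinuous_map_openin:
  assumes "upper_semicontinuous_map T h"
  shows "openin T {p \<in> topspace T. h p < c}"
  using lower_semicontinuous_map_openin[of T "\<lambda>p. - h p" "- c"] assms
  by (simp add: lower_semicontinuous_map_uminus)

text \<open>The open sets \<open>?U c\<close> cover the compact sublevel set at level 0, so finitely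
  many thresholds bound \<open>h\<close> there; elsewhere \<open>h\<close> is positive. This later
  keeps the minimax value finite.\<close>

lemma lower_semicontinuous_map_bounded_below:
  assumes lsc: "lower_semicontinuous_map (subtopology S X) h"
    and X: "X \<subseteq> topspace S"
    and cpt: "compactin S {p \<in> X. h p \<le> 0}"
  obtains b where "\<And>p. p \<in> X \<Longrightarrow> b \<le> h p"
proof -
  let ?U = "\<lambda>c. {p \<in> X. c < h p}"
  have "topspace (subtopology S X) = X"
    using X by auto
  then have "openin (subtopology S X) (?U c)" for c
    using lower_semicontinuous_map_openin[OF lsc, of c] by simp
  moreover have "{p \<in> X. h p \<le> 0} \<subseteq> \<Union> (range ?U)"
    using lt_ex by auto
  moreover have "compactin (subtopology S X) {p \<in> X. h p \<le> 0}"
    using cpt by (auto simp: compactin_subtopology)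
  ultimately have "\<exists>\<F>. finite \<F> \<and> \<F> \<subseteq> range ?U \<and> {p \<in> X. h p \<le> 0} \<subseteq> \<Union> \<F>"
    by (intro compactinD) auto
  then obtain C where C: "finite C" "{p \<in> X. h p \<le> 0} \<subseteq> \<Union> (?U ` C)"
    by (metis (lifting) finite_subset_image)
  \<comment> \<open>The inserted 0 bounds \<open>h\<close> off the sublevel set and keeps
    \<open>Min\<close> meaningful when \<open>C\<close> is empty.\<close>
  have "Min (insert 0 C) \<le> h p" if "p \<in> X" for p
  proof (cases "h p \<le> 0")
    case True
    then obtain c where "c \<in> C" "c < h p"
      using C(2) \<open>p \<in> X\<close> by blast
    moreover have "Min (insert 0 C) \<le> c"
      using C(1) \<open>c \<in> C\<close> by (intro Min_le) auto
    ultimately show ?thesis by simp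
  next
    case False
    moreover have "Min (insert 0 C) \<le> 0"
      using C(1) by (intro Min_le) auto
    ultimately show ?thesis by simp
  qed
  then show thesis by (rule that)
qed

section \<open>The minimax argument\<close>

locale quasi_convex_concave =
  fixes M :: "('a, 'd::euclidean_space) riem_data"
    and N :: "('b, 'e::euclidean_space) riem_data"
    and X :: "'a set" and Y :: "'b set"
    and f :: "'a \<Rightarrow> 'b \<Rightarrow> real"
  assumes g_convex_X: "g_convex M X" and uniquely_geodesic_X: "uniquely_geodesic M X"
    and g_convex_Y: "g_convex N Y" and uniquely_geodesic_Y: "uniquely_geodesic N Y"
    and lsc: "y \<in> Y \<Longrightarrow> lower_semicontinuous_map (subtopology (mtop M) X) (\<lambda>x. f x y)"
    and quasi_convex: "y \<in> Y \<Longrightarrow> quasi_g_convex M X (\<lambda>x. f x y)"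
    and usc: "x \<in> X \<Longrightarrow> upper_semicontinuous_map (subtopology (mtop N) Y) (f x)"
    and quasi_concave: "x \<in> X \<Longrightarrow> quasi_g_concave N Y (f x)"
begin

lemma openin_superlevel:
  assumes "y \<in> Y"
  shows "openin (subtopology (mtop M) X) {x \<in> X. c < f x y}"
proof -
  have "topspace (subtopology (mtop M) X) = X"
    using g_convex_X by (auto simp: g_convex_def)
  then show ?thesis
    using lower_semicontinuous_map_openin[OF lsc[OF assms], of c] by simp
qed

lemma openin_sublevel:
  assumes "x \<in> X"
  shows "openin (subtopology (mtop N) Y) {y \<in> Y. f x y < c}"
proof -
  have "topspace (subtopology (mtop N) Y) = Y"
    using g_convex_Y by (auto simp: g_convex_def)
  then show ?thesis
    using upper_semicontinuous_map_openin[OF usc[OF assms], of c] by simp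
qed

text \<open>The hypotheses survive swapping the two spaces and negating \<open>f\<close>, so a
  maximizer in \<open>Y\<close> comes from the same lemma as a minimizer in
  \<open>X\<close>.\<close>

lemma dual: "quasi_convex_concave N M Y X (\<lambda>y x. - f x y)"
proof
  show "lower_semicontinuous_map (subtopology (mtop N) Y) (\<lambda>y. - f x y)" if "x \<in> X" for x
    using usc[OF that] by (simp add: lower_semicontinuous_map_uminus)
  show "upper_semicontinuous_map (subtopology (mtop M) X) (\<lambda>x. - f x y)" if "y \<in> Y" for y
    using lsc[OF that] by (simp flip: lower_semicontinuous_map_uminus)
  show "quasi_g_convex N Y (\<lambda>y. - f x y)" if "x \<in> X" for x
    unfolding quasi_g_convex_def
  proof
    fix \<alpha>
    have "{y \<in> Y. - f x y \<le> \<alpha>} = {y \<in> Y. f x y \<ge> - \<alpha>}" by auto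
    then show "g_convex N {y \<in> Y. - f x y \<le> \<alpha>}"
      using quasi_concave[OF that] by (simp add: quasi_g_concave_def)
  qed
  show "quasi_g_concave M X (\<lambda>x. - f x y)" if "y \<in> Y" for y
    unfolding quasi_g_concave_def
  proof
    fix \<alpha>
    have "{x \<in> X. \<alpha> \<le> - f x y} = {x \<in> X. f x y \<le> - \<alpha>}" by auto
    then show "g_convex M {x \<in> X. \<alpha> \<le> - f x y}"
      using quasi_convex[OF that] by (simp add: quasi_g_convex_def)
  qed
qed (fact g_convex_X uniquely_geodesic_X g_convex_Y uniquely_geodesic_Y)+

lemma g_convex_Int_sublevel:
  assumes "A \<subseteq> X" "g_convex M A" "y \<in> Y"
  shows "g_convex M (A \<inter> {x \<in> X. f x y \<le> c})"
  using assms quasi_convex[of y] uniquely_geodesic_X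
  by (intro uniquely_geodesic_g_convex_Int) (auto simp: quasi_g_convex_def)

text \<open>The set \<open>A\<close> is general so that an induction can shrink it to sublevel sets.
  The gap between \<alpha> and \<beta> lets nonempty sublevel sets at \<alpha> give strict
  inequalities at \<beta>, which are open conditions on \<open>z\<close>.\<close>

lemma two_point_minimax:
  assumes A: "A \<subseteq> X" "g_convex M A"
    and y: "y \<in> Y" "y' \<in> Y"
    and "\<alpha> < \<beta>"
    and sep: "\<And>x. x \<in> A \<Longrightarrow> \<beta> < f x y \<or> \<beta> < f x y'"
  shows "\<exists>z\<in>Y. \<forall>x\<in>A. \<alpha> < f x z"
proof (rule ccontr)
  assume "\<not> ?thesis"
  then have nonempty: "\<exists>x\<in>A. f x z \<le> \<alpha>" if "z \<in> Y" for z
    using that by (meson not_le)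
  obtain Z where Z: "connectedin (mtop N) Z" "y \<in> Z" "y' \<in> Z"
    and Z_sub: "\<And>B. g_convex N B \<Longrightarrow> y \<in> B \<Longrightarrow> y' \<in> B \<Longrightarrow> Z \<subseteq> B"
    using uniquely_geodesic_segment[OF uniquely_geodesic_Y y] by blast
  have ZY: "Z \<subseteq> Y"
    using Z_sub g_convex_Y y by blast
  \<comment> \<open>The superlevel set of \<open>f x\<close> at the smaller endpoint value is
    g-convex and contains both endpoints, hence all of \<open>Z\<close>.\<close>
  have min_le: "min (f x y) (f x y') \<le> f x z" if "x \<in> A" "z \<in> Z" for x z
    using Z_sub[of "{w \<in> Y. f x w \<ge> min (f x y) (f x y')}"] quasi_concave[of x] that A y
    by (auto simp: quasi_g_concave_def)
  have one_side: "(\<forall>x\<in>A. f x z \<le> \<beta> \<longrightarrow> f x y \<le> \<beta>) \<or> (\<forall>x\<in>A. f x z \<le> \<beta> \<longrightarrow> f x y' \<le> \<beta>)"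
    if "z \<in> Z" for z
  proof (rule ccontr)
    assume neg: "\<not> ?thesis"
    \<comment> \<open>By \<open>sep\<close> the open sets \<open>?U y\<close> and
      \<open>?U y'\<close> cover \<open>?E\<close>; by \<open>min_le\<close> no point of
      \<open>?E\<close> lies in both. Connectedness of \<open>?E\<close> then excludes meeting
      both.\<close>
    let ?E = "A \<inter> {x \<in> X. f x z \<le> \<beta>}"
    let ?U = "\<lambda>w. {x \<in> X. \<beta> < f x w}"
    have "connectedin (mtop M) ?E"
      using A ZY that by (intro g_convex_imp_connectedin g_convex_Int_sublevel) auto
    then have "connectedin (subtopology (mtop M) X) ?E"
      by (auto simp: connectedin_subtopology)
    moreover have "?E \<subseteq> ?U y \<union> ?U y'"
      using sep by blast
    moreover have "?U y \<inter> ?U y' \<inter> ?E = {}"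
      using min_le[OF _ that] by fastforce
    moreover have "?U y \<inter> ?E \<noteq> {}" "?U y' \<inter> ?E \<noteq> {}"
      using neg A by (auto simp: not_le)
    ultimately show False
      using openin_superlevel[OF y(1), of \<beta>] openin_superlevel[OF y(2), of \<beta>]
      unfolding connectedin by blast
  qed
  \<comment> \<open>\<open>V w\<close> collects the \<open>z\<close> whose strict sublevel set at
    \<beta> meets the sublevel set of \<open>w\<close> within \<open>A\<close>. As a union over
    \<open>x\<close> it is open by upper semicontinuity alone. \<open>V y\<close> and
    \<open>V y'\<close> will disconnect \<open>Z\<close>.\<close>
  define V where "V w = (\<Union>x\<in>{x \<in> A. f x w \<le> \<beta>}. {z \<in> Y. f x z < \<beta>})" for w
  have "openin (subtopology (mtop N) Y) (V w)" for w
    unfolding V_def using A openin_sublevel by (intro openin_Union) auto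
  moreover have "connectedin (subtopology (mtop N) Y) Z"
    using Z ZY by (simp add: connectedin_subtopology)
  moreover have "Z \<subseteq> V y \<union> V y'"
  proof
    fix z assume "z \<in> Z"
    obtain x where "x \<in> A" "f x z \<le> \<alpha>"
      using nonempty \<open>z \<in> Z\<close> ZY by blast
    moreover from this have "f x y \<le> \<beta> \<or> f x y' \<le> \<beta>"
      using min_le[of x z] \<open>z \<in> Z\<close> \<open>\<alpha> < \<beta>\<close> by linarith
    moreover have "z \<in> Y" "f x z < \<beta>"
      using \<open>z \<in> Z\<close> ZY \<open>f x z \<le> \<alpha>\<close> \<open>\<alpha> < \<beta>\<close> by auto
    ultimately show "z \<in> V y \<union> V y'"
      unfolding V_def by blast
  qed
  \<comment> \<open>For a common point, \<open>one_side\<close> would move \<open>x\<close> or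
    \<open>x'\<close> into the sublevel sets of both \<open>y\<close> and \<open>y'\<close>, against
    \<open>sep\<close>.\<close>
  moreover have "V y \<inter> V y' \<inter> Z = {}"
  proof (rule ccontr)
    assume "V y \<inter> V y' \<inter> Z \<noteq> {}"
    then obtain z x x' where "z \<in> Z" "x \<in> A" "f x z < \<beta>" "f x y \<le> \<beta>"
      and "x' \<in> A" "f x' z < \<beta>" "f x' y' \<le> \<beta>"
      unfolding V_def by blast
    then show False
      using one_side[of z] sep[of x] sep[of x'] by force
  qed
  moreover have "V y \<inter> Z \<noteq> {}" "V y' \<inter> Z \<noteq> {}"
  proof -
    have "w \<in> V w" if "w \<in> Y" for w
    proof -
      obtain x where "x \<in> A" "f x w \<le> \<alpha>"
        using nonempty[OF \<open>w \<in> Y\<close>] by blast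
      then have "x \<in> {x \<in> A. f x w \<le> \<beta>}" "w \<in> {z \<in> Y. f x z < \<beta>}"
        using \<open>\<alpha> < \<beta>\<close> that by auto
      then show ?thesis
        unfolding V_def by blast
    qed
    then show "V y \<inter> Z \<noteq> {}" "V y' \<inter> Z \<noteq> {}"
      using y Z by auto
  qed
  ultimately show False
    unfolding connectedin by metis
qed

text \<open>Where \<open>f x y\<close> exceeds \<beta> the new point \<open>y\<close> suffices; on
  the remaining part of \<open>A\<close> the induction hypothesis replaces \<open>F\<close> by a
  single \<open>z\<close>. The two-point case then merges \<open>z\<close> and \<open>y\<close>.
  Both \<open>A\<close> and \<alpha> change on the way, so both are generalized.\<close>

lemma finite_minimax:
  assumes "finite F" "F \<subseteq> Y" "Y \<noteq> {}" "A \<subseteq> X" "g_convex M A" "\<alpha> < \<beta>"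
    and "\<And>x. x \<in> A \<Longrightarrow> \<exists>y\<in>F. \<beta> < f x y"
  shows "\<exists>z\<in>Y. \<forall>x\<in>A. \<alpha> < f x z"
  using assms
proof (induction F arbitrary: A \<alpha> rule: finite_induct)
  case empty
  \<comment> \<open>Without points in \<open>F\<close> the covering hypothesis forces
    \<open>A\<close> to be empty, and any point of \<open>Y\<close> works.\<close>
  then show ?case by blast
next
  case (insert y F)
  let ?A = "A \<inter> {x \<in> X. f x y \<le> \<beta>}"
  \<comment> \<open>An intermediate level splits the gap: the induction hypothesis uses the upper
    part, the two-point case the lower.\<close>
  define \<delta> where "\<delta> = (\<alpha> + \<beta>) / 2"
  have \<delta>: "\<alpha> < \<delta>" "\<delta> < \<beta>"
    using insert.prems by (auto simp: \<delta>_def)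
  have "\<exists>z\<in>Y. \<forall>x\<in>?A. \<delta> < f x z"
  proof (rule insert.IH)
    show "g_convex M ?A"
      using insert.prems by (intro g_convex_Int_sublevel) auto
    show "\<exists>y\<in>F. \<beta> < f x y" if "x \<in> ?A" for x
      using insert.prems(6)[of x] that by auto
  qed (use insert.prems \<delta> in auto)
  then obtain z where z: "z \<in> Y" "\<And>x. x \<in> ?A \<Longrightarrow> \<delta> < f x z"
    by blast
  show ?case
  proof (rule two_point_minimax[OF _ _ z(1) _ \<delta>(1)])
    show "\<delta> < f x z \<or> \<delta> < f x y" if "x \<in> A" for x
      using z(2)[of x] that insert.prems(3) \<delta>(2) by (cases "f x y \<le> \<beta>") auto
  qed (use insert.prems in auto)
qed

text \<open>If every \<open>x\<close> had some \<open>y\<close> with \<open>f x y\<close> above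
  \<open>v\<close>, compactness would leave finitely many such \<open>y\<close> with a uniform
  margin, and \<open>finite_minimax\<close> would merge them into one \<open>z\<close> whose infimum
  exceeds \<open>v\<close>.\<close>

lemma minimizer_exists:
  assumes y1: "y\<^sub>1 \<in> Y"
    and cpt: "\<And>c. compactin (mtop M) {x \<in> X. f x y\<^sub>1 \<le> c}"
    and v: "\<And>y c. y \<in> Y \<Longrightarrow> v < c \<Longrightarrow> \<exists>x\<in>X. f x y < c"
  shows "\<exists>x\<in>X. \<forall>y\<in>Y. f x y \<le> v"
proof (rule ccontr)
  assume neg: "\<not> ?thesis"
  let ?K = "{x \<in> X. f x y\<^sub>1 \<le> v + 1}"
  let ?U = "\<lambda>(y, c). {x \<in> X. c < f x y}"
  let ?I = "Y \<times> {v<..}"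
  have "compactin (subtopology (mtop M) X) ?K"
    using cpt by (auto simp: compactin_subtopology)
  moreover have "openin (subtopology (mtop M) X) W" if "W \<in> ?U ` ?I" for W
    using that openin_superlevel by auto
  moreover have "?K \<subseteq> \<Union> (?U ` ?I)"
  proof
    fix x assume x: "x \<in> ?K"
    then obtain y where "y \<in> Y" "v < f x y"
      using neg by (auto simp: not_le)
    then obtain c where "v < c" "c < f x y"
      using dense by blast
    then show "x \<in> \<Union> (?U ` ?I)"
      using x \<open>y \<in> Y\<close> by auto
  qed
  ultimately have "\<exists>\<F>. finite \<F> \<and> \<F> \<subseteq> ?U ` ?I \<and> ?K \<subseteq> \<Union> \<F>"
    by (intro compactinD) auto
  then obtain P where P: "finite P" "P \<subseteq> ?I" "?K \<subseteq> \<Union> (?U ` P)"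
    by (metis (lifting) finite_subset_image)
  \<comment> \<open>This is the uniform margin: a minimum of finitely many numbers above
    \<open>v\<close>. The entry \<open>v + 1\<close> accounts for points outside \<open>?K\<close>,
    where \<open>y\<^sub>1\<close> itself does the job.\<close>
  define \<beta> where "\<beta> = Min (insert (v + 1) (snd ` P))"
  have "\<beta> \<in> insert (v + 1) (snd ` P)"
    unfolding \<beta>_def using P(1) by (intro Min_in) auto
  then have "v < \<beta>"
    using P(2) by auto
  have \<beta>_le: "\<beta> \<le> c" if "c \<in> insert (v + 1) (snd ` P)" for c
    unfolding \<beta>_def using P(1) that by (intro Min_le) auto
  obtain \<alpha> where \<alpha>: "v < \<alpha>" "\<alpha> < \<beta>"
    using dense[OF \<open>v < \<beta>\<close>] by blast
  have "\<exists>z\<in>Y. \<forall>x\<in>X. \<alpha> < f x z"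
  proof (rule finite_minimax[OF _ _ _ subset_refl g_convex_X \<alpha>(2)])
    show "\<exists>y\<in>insert y\<^sub>1 (fst ` P). \<beta> < f x y" if "x \<in> X" for x
    proof (cases "x \<in> ?K")
      case True
      then obtain p where p: "p \<in> P" "snd p < f x (fst p)"
        using P(3) by fastforce
      with \<beta>_le[of "snd p"] have "\<beta> < f x (fst p)"
        by fastforce
      then show ?thesis using p(1) by blast
    next
      case False
      then show ?thesis using \<beta>_le[of "v + 1"] that by auto
    qed
  qed (use P y1 in auto)
  then show False
    using v[OF _ \<alpha>(1)] by fastforce
qed

end

theorem theorem3:
  fixes M :: "('a, 'd::euclidean_space) riem_data"
    and N :: "('b, 'e::euclidean_space) riem_data"
    and X :: "'a set" and Y :: "'b set"
    and f :: "'a \<Rightarrow> 'b \<Rightarrow> real"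
  assumes "riemannian_manifold M" and "riemannian_manifold N"
    and "X \<subseteq> topspace (mtop M)" and "Y \<subseteq> topspace (mtop N)"
    and "g_convex M X" and "uniquely_geodesic M X"
    and "g_convex N Y" and "uniquely_geodesic N Y"
    and "\<And>y. y \<in> Y \<Longrightarrow> lower_semicontinuous_map (subtopology (mtop M) X) (\<lambda>x. f x y)"
    and "\<And>y. y \<in> Y \<Longrightarrow> quasi_g_convex M X (\<lambda>x. f x y)"
    and "\<And>x. x \<in> X \<Longrightarrow> upper_semicontinuous_map (subtopology (mtop N) Y) (f x)"
    and "\<And>x. x \<in> X \<Longrightarrow> quasi_g_concave N Y (f x)"
    and "\<exists>x\<^sub>1\<in>X. \<exists>y\<^sub>1\<in>Y. inf_sup_compact_at (mtop M) (mtop N) X Y f x\<^sub>1 y\<^sub>1"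
  shows "\<exists>v. is_min_max X Y f v \<and> is_max_min X Y f v"
proof -
  interpret quasi_convex_concave M N X Y f
    by unfold_locales (fact assms)+
  interpret dual: quasi_convex_concave N M Y X "\<lambda>y x. - f x y"
    by (rule dual)
  obtain x\<^sub>1 y\<^sub>1 where x1: "x\<^sub>1 \<in> X" and y1: "y\<^sub>1 \<in> Y"
    and "inf_sup_compact_at (mtop M) (mtop N) X Y f x\<^sub>1 y\<^sub>1"
    using assms(13) by blast
  then have cptX: "compactin (mtop M) {x \<in> X. f x y\<^sub>1 \<le> c}"
    and cptY': "compactin (mtop N) {y \<in> Y. f x\<^sub>1 y \<ge> - c}" for c
    unfolding inf_sup_compact_at_def by blast+
  have cptY: "compactin (mtop N) {y \<in> Y. - f x\<^sub>1 y \<le> c}" for c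
    using cptY'[of c] by (simp add: minus_le_iff)
  obtain b where b: "\<And>x. x \<in> X \<Longrightarrow> b \<le> f x y\<^sub>1"
    using lower_semicontinuous_map_bounded_below[OF lsc[OF y1] assms(3) cptX] by blast
  obtain b' where b': "\<And>y. y \<in> Y \<Longrightarrow> b' \<le> - f x\<^sub>1 y"
    using lower_semicontinuous_map_bounded_below[OF dual.lsc[OF x1] assms(4) cptY] by blast
  \<comment> \<open>The common value will be the max-min value, shown finite by the bounds at
    \<open>y\<^sub>1\<close> and \<open>x\<^sub>1\<close>.\<close>
  define w where "w = (SUP y\<in>Y. INF x\<in>X. ereal (f x y))"
  have "ereal b \<le> (INF x\<in>X. ereal (f x y\<^sub>1))"
    using b by (intro INF_greatest) simp
  also have "\<dots> \<le> w"
    unfolding w_def using y1 by (rule SUP_upper)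
  finally have "ereal b \<le> w" .
  moreover have "w \<le> ereal (- b')"
    unfolding w_def
  proof (rule SUP_least)
    fix y assume "y \<in> Y"
    have "(INF x\<in>X. ereal (f x y)) \<le> ereal (f x\<^sub>1 y)"
      using x1 by (rule INF_lower)
    also have "\<dots> \<le> ereal (- b')"
      using b'[OF \<open>y \<in> Y\<close>] by simp
    finally show "(INF x\<in>X. ereal (f x y)) \<le> ereal (- b')" .
  qed
  ultimately obtain v where v: "w = ereal v"
    by (cases w) auto
  have INF_le: "(INF x\<in>X. ereal (f x y)) \<le> ereal v" if "y \<in> Y" for y
    unfolding v[symmetric] w_def using that by (rule SUP_upper)
  obtain x where x: "x \<in> X" "\<And>y. y \<in> Y \<Longrightarrow> f x y \<le> v"
  proof -
    have "\<exists>x\<in>X. f x y < c" if "y \<in> Y" "v < c" for y c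
      using le_less_trans[OF INF_le[OF that(1)], of "ereal c"] that(2) by (auto simp: INF_less_iff)
    from minimizer_exists[OF y1 cptX this] that show thesis by blast
  qed
  \<comment> \<open>Weak duality. It supplies the approximation hypothesis of the dual lemma at the
    value \<open>- v\<close>.\<close>
  have SUP_ge: "ereal v \<le> (SUP y\<in>Y. ereal (f x y))" if "x \<in> X" for x
    unfolding v[symmetric] w_def using that by (intro SUP_mono) (auto intro: INF_lower)
  obtain y where y: "y \<in> Y" "\<And>x. x \<in> X \<Longrightarrow> v \<le> f x y"
  proof -
    have "\<exists>y\<in>Y. - f x y < c" if "x \<in> X" "- v < c" for x c
    proof -
      have "ereal (- c) < ereal v"
        using that(2) by simp
      also have "\<dots> \<le> (SUP y\<in>Y. ereal (f x y))"
        using that(1) by (rule SUP_ge)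
      finally have "\<exists>y\<in>Y. ereal (- c) < ereal (f x y)"
        by (simp only: less_SUP_iff)
      then show ?thesis by (auto simp: minus_less_iff)
    qed
    from dual.minimizer_exists[OF x1 cptY this] that show thesis by fastforce
  qed
  \<comment> \<open>The pair is a saddle point, so both minimax values and their attainment can be
    read off from it.\<close>
  have fxy: "f x y = v"
    using x y by (simp add: antisym)
  have SUP_x: "(SUP y\<in>Y. ereal (f x y)) = ereal v"
    using x SUP_ge[OF x(1)] by (intro antisym SUP_least) auto
  have INF_y: "(INF x\<in>X. ereal (f x y)) = ereal v"
    using y INF_le[OF y(1)] by (intro antisym INF_greatest) auto
  have "(INF x\<in>X. SUP y\<in>Y. ereal (f x y)) = ereal v"
    using SUP_ge INF_lower[OF x(1), of "\<lambda>x. SUP y\<in>Y. ereal (f x y)"] SUP_x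
    by (intro antisym INF_greatest) auto
  then have "is_min_max X Y f v"
    unfolding is_min_max_def using SUP_x fxy x(1) y(1) by blast
  moreover have "is_max_min X Y f v"
    unfolding is_max_min_def using v w_def INF_y fxy x(1) y(1) by auto
  ultimately show ?thesis by blast
qed

end
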